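(* Let $N,K\ge 1$ be integers, $\mathcal N=\{1,\dots,N\}$, $\mathcal K=\{1,\dots,K\}$. Let $(\boldsymbol q_n,r_n)$, $n\in\mathcal N$, be data points consisting of a location vector $\boldsymbol q_n$ and a real number $r_n$, let $d_n=10\log_{10}\|\boldsymbol q_n\|$, and let $\gamma_{nk}$ ($n\in\mathcal N$, $k\in\mathcal K$) be the responsibilities defined in the context. For each $k\in\mathcal K$ consider the optimization problem $$\min_{\alpha_k,\ \beta_k,\ \sigma_k^2}\ \sum_{n\in\mathcal N}\gamma_{nk}\left[\ln\sigma_k^2+\frac{(r_n-\beta_k-\alpha_k d_n)^2}{\sigma_k^2}\right].$$ The optimal solution to this problem is $$\alpha_k=\frac{\overline{(d_kr_k)}-\overline{d_k}\,\overline{r_k}}{\overline{d_k^2}-\overline{d_k}^{\,2}},\qquad \beta_k=\frac{\overline{d_k^2}\,\overline{r_k}-\overline{d_k}\,\overline{(d_kr_k)}}{\overline{d_k^2}-\overline{d_k}^{\,2}},$$ $$\sigma_k^2=\frac{\sum_{n\in\mathcal N}\gamma_{nk}(r_n-\beta_k-\alpha_kd_n)^2}{N_k},$$ where $$\overline{d_k}=\frac{\sum_{n\in\mathcal N}\gamma_{nk}d_n}{N_k},\quad \overline{r_k}=\frac{\sum_{n\in\mathcal N}\gamma_{nk}r_n}{N_k},\quad \overline{(d_kr_k)}=\frac{\sum_{n\in\mathcal N}\gamma_{nk}d_nr_n}{N_k},\quad \overline{d_k^2}=\frac{\sum_{n\in\mathcal N}\gamma_{nk}d_n^2}{N_k},$$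 with $N_k=\sum_{n\in\mathcal N}\gamma_{nk}$ for all $k\in\mathcal K$.
   Context: Here $\|\cdot\|$ is the Euclidean norm and $N(r|\mu,\sigma^2)=\frac{1}{\sqrt{2\pi\sigma^2}}\exp\left(-\frac{(r-\mu)^2}{2\sigma^2}\right)$ denotes the density of a Gaussian random variable with mean $\mu$ and variance $\sigma^2$. In the optimization problem $\alpha_k,\beta_k$ are real variables and $\sigma_k^2$ is a variance variable: $(\alpha_k,\beta_k,\sigma_k^2)$ are the parameters of the $k$-th component of a mixture model, in which $r$ at location $\boldsymbol q$ is Gaussian with mean $\beta_k+10\alpha_k\log_{10}\|\boldsymbol q\|$ and variance $\sigma_k^2$. The responsibilities are computed from given (old) parameter values $\alpha_j^{\text{old}},\beta_j^{\text{old}},(\sigma_j^{\text{old}})^2$ and mixing coefficients $\pi_j^{\text{old}}\in[0,1]$ with $\sum_{j\in\mathcal K}\pi_j^{\text{old}}=1$, by $$\gamma_{nk}=\frac{\pi_k^{\text{old}}\,N\big(r_n\,\big|\,\beta_k^{\text{old}}+\alpha_k^{\text{old}}d_n,(\sigma_k^{\text{old}})^2\big)}{\sum_{j\in\mathcal K}\pi_j^{\text{old}}\,N\big(r_n\,\big|\,\beta_j^{\text{old}}+\alpha_j^{\text{old}}d_n,(\sigma_j^{\text{old}})^2\big)},$$ and they are constants in the optimization problem. The overlined symbols are merely names for the weighted averages defined in the claim; in particular $\overline{d_k}^{\,2}$ is the square of $\overline{d_k}$, whereas $\overline{d_k^2}$ is the weighted average of the $d_n^2$.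
   Formalization: Assumes all q_n nonzero, the old mixing coefficient of component k positive, the d_n not all equal, and the points (d_n, r_n) not all on one line r = b + a d; otherwise the formulas are undefined or no minimum exists (e.g. N = 1 or 2). *)

theory Defs
  imports "HOL-Probability.Probability"
begin

definition log_distance :: "(nat \<Rightarrow> 'a::euclidean_space) \<Rightarrow> nat \<Rightarrow> real" where
  "log_distance q n = 10 * log 10 (norm (q n))"

text \<open>Note that \<^const>\<open>normal_density\<close> takes the standard deviation, not the variance, as its
  second argument; so \<open>\<sigma>\<close> is a standard deviation here.\<close>

definition responsibility ::
  "nat \<Rightarrow> (nat \<Rightarrow> real) \<Rightarrow> (nat \<Rightarrow> real) \<Rightarrow> (nat \<Rightarrow> real) \<Rightarrow> (nat \<Rightarrow> real) \<Rightarrow>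
   (nat \<Rightarrow> real) \<Rightarrow> (nat \<Rightarrow> real) \<Rightarrow> nat \<Rightarrow> nat \<Rightarrow> real" where
  "responsibility K mix \<alpha> \<beta> \<sigma> d r n k =
     mix k * normal_density (\<beta> k + \<alpha> k * d n) (\<sigma> k) (r n) /
     (\<Sum>j\<in>{1..K}. mix j * normal_density (\<beta> j + \<alpha> j * d n) (\<sigma> j) (r n))"

definition component_size :: "nat \<Rightarrow> (nat \<Rightarrow> nat \<Rightarrow> real) \<Rightarrow> nat \<Rightarrow> real" where
  "component_size N \<gamma> k = (\<Sum>n\<in>{1..N}. \<gamma> n k)"

definition weighted_mean ::
  "nat \<Rightarrow> (nat \<Rightarrow> nat \<Rightarrow> real) \<Rightarrow> nat \<Rightarrow> (nat \<Rightarrow> real) \<Rightarrow> real" where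
  "weighted_mean N \<gamma> k x = (\<Sum>n\<in>{1..N}. \<gamma> n k * x n) / component_size N \<gamma> k"

text \<open>The third optimization variable \<open>v\<close> is the variance \<open>\<sigma>\<^sup>2\<close> itself.\<close>

definition objective ::
  "nat \<Rightarrow> (nat \<Rightarrow> nat \<Rightarrow> real) \<Rightarrow> (nat \<Rightarrow> real) \<Rightarrow> (nat \<Rightarrow> real) \<Rightarrow> nat \<Rightarrow>
   real \<times> real \<times> real \<Rightarrow> real" where
  "objective N \<gamma> d r k = (\<lambda>(a, b, v).
     \<Sum>n\<in>{1..N}. \<gamma> n k * (ln v + (r n - b - a * d n)\<^sup>2 / v))"

definition feasible :: "real \<times> real \<times> real \<Rightarrow> bool" where
  "feasible = (\<lambda>(a, b, v). v > 0)"

definition opt_alpha ::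
  "nat \<Rightarrow> (nat \<Rightarrow> nat \<Rightarrow> real) \<Rightarrow> (nat \<Rightarrow> real) \<Rightarrow> (nat \<Rightarrow> real) \<Rightarrow> nat \<Rightarrow> real" where
  "opt_alpha N \<gamma> d r k =
     (weighted_mean N \<gamma> k (\<lambda>n. d n * r n) - weighted_mean N \<gamma> k d * weighted_mean N \<gamma> k r) /
     (weighted_mean N \<gamma> k (\<lambda>n. (d n)\<^sup>2) - (weighted_mean N \<gamma> k d)\<^sup>2)"

definition opt_beta ::
  "nat \<Rightarrow> (nat \<Rightarrow> nat \<Rightarrow> real) \<Rightarrow> (nat \<Rightarrow> real) \<Rightarrow> (nat \<Rightarrow> real) \<Rightarrow> nat \<Rightarrow> real" where
  "opt_beta N \<gamma> d r k =
     (weighted_mean N \<gamma> k (\<lambda>n. (d n)\<^sup>2) * weighted_mean N \<gamma> k r -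
      weighted_mean N \<gamma> k d * weighted_mean N \<gamma> k (\<lambda>n. d n * r n)) /
     (weighted_mean N \<gamma> k (\<lambda>n. (d n)\<^sup>2) - (weighted_mean N \<gamma> k d)\<^sup>2)"

definition opt_variance ::
  "nat \<Rightarrow> (nat \<Rightarrow> nat \<Rightarrow> real) \<Rightarrow> (nat \<Rightarrow> real) \<Rightarrow> (nat \<Rightarrow> real) \<Rightarrow> nat \<Rightarrow> real" where
  "opt_variance N \<gamma> d r k =
     (\<Sum>n\<in>{1..N}. \<gamma> n k * (r n - opt_beta N \<gamma> d r k - opt_alpha N \<gamma> d r k * d n)\<^sup>2) /
     component_size N \<gamma> k"

end

(* With the fitted coefficients A, B, the weighted residuals are orthogonal to the constants and
   to d, so RSS(a, b) = RSS(A, B) + (a weighted sum of squares of B - b + (A - a) d).  With W the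
   total weight and V = RSS(A, B) / W, the objective at (a, b, v) therefore exceeds its value at
   (A, B, V) by W (V/v - 1 - ln (V/v)) plus that sum of squares divided by v.  Both terms are
   nonnegative; the first vanishes only for v = V and the second only for (a, b) = (A, B). *)

theory Submission
  imports Defs
begin

text \<open>Gaussian densities are positive, so the \<open>k\<close>-th summand alone makes the
  denominator positive. Hence every data point has positive weight, and the lemmas below can work
  with arbitrary positive weights \<gamma>.\<close>

lemma responsibility_pos:
  assumes "\<forall>j\<in>{1..K}. 0 \<le> mix j" "\<forall>j\<in>{1..K}. \<sigma> j > 0" "k \<in> {1..K}" "mix k > 0"
  shows "responsibility K mix \<alpha> \<beta> \<sigma> d r n k > 0"
proof -
  have pos: "mix k * normal_density (\<beta> k + \<alpha> k * d n) (\<sigma> k) (r n) > 0"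
    using assms by (simp add: normal_density_pos)
  have "0 < (\<Sum>j\<in>{1..K}. mix j * normal_density (\<beta> j + \<alpha> j * d n) (\<sigma> j) (r n))"
    using assms(1,3) pos by (intro sum_pos2[where i = k]) auto
  with pos show ?thesis
    unfolding responsibility_def by (rule divide_pos_pos)
qed

lemma component_size_pos:
  assumes "N \<ge> 1" "\<forall>n\<in>{1..N}. \<gamma> n k > 0"
  shows "component_size N \<gamma> k > 0"
  unfolding component_size_def using assms by (intro sum_pos) auto

lemma weighted_sum_eq:
  assumes "component_size N \<gamma> k \<noteq> 0"
  shows "(\<Sum>n\<in>{1..N}. \<gamma> n k * x n) = component_size N \<gamma> k * weighted_mean N \<gamma> k x"
  using assms by (simp add: weighted_mean_def)

text \<open>This common denominator of \<open>opt_alpha\<close> and \<open>opt_beta\<close> is the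
  weighted variance of \<open>d\<close>, that is, the weighted average of the squares of
  \<open>d n - \<mu>\<close>.\<close>

lemma weighted_variance_pos:
  assumes pos: "\<forall>n\<in>{1..N}. \<gamma> n k > 0"
    and not_const: "\<exists>m\<in>{1..N}. \<exists>n\<in>{1..N}. d m \<noteq> d n"
  shows "weighted_mean N \<gamma> k (\<lambda>n. (d n)\<^sup>2) - (weighted_mean N \<gamma> k d)\<^sup>2 > 0"
proof -
  define W where "W = component_size N \<gamma> k"
  define \<mu> where "\<mu> = weighted_mean N \<gamma> k d"
  from not_const have "N \<ge> 1" by auto
  then have W: "W > 0"
    unfolding W_def using pos by (rule component_size_pos)
  \<comment> \<open>Two distinct values of \<open>d\<close> cannot both equal the mean.\<close>
  obtain m where m: "m \<in> {1..N}" "d m \<noteq> \<mu>"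
    using not_const by metis
  have "0 < (\<Sum>n\<in>{1..N}. \<gamma> n k * (d n - \<mu>)\<^sup>2)"
    by (rule sum_pos2[OF _ m(1)]) (use pos m in \<open>auto simp: less_imp_le\<close>)
  also have "\<dots> = (\<Sum>n\<in>{1..N}. \<gamma> n k * (d n)\<^sup>2) - 2 * \<mu> * (\<Sum>n\<in>{1..N}. \<gamma> n k * d n)
      + \<mu>\<^sup>2 * W"
    by (simp add: W_def component_size_def sum_distrib_left power2_diff
        flip: sum.distrib sum_subtractf) (simp add: algebra_simps)
  also have "\<dots> = W * (weighted_mean N \<gamma> k (\<lambda>n. (d n)\<^sup>2) - \<mu>\<^sup>2)"
    by (simp only: weighted_sum_eq[OF W[THEN less_imp_neq, symmetric, unfolded W_def]] W_def \<mu>_def)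
      (simp add: power2_eq_square algebra_simps)
  finally show ?thesis
    using W by (simp add: \<mu>_def zero_less_mult_iff)
qed

text \<open>These are the stationarity conditions in the intercept and the slope. They form a 2x2
  linear system, which \<open>opt_alpha\<close> and \<open>opt_beta\<close> solve by Cramer's rule
  with determinant \<open>?D\<close> after division by \<open>?W\<close>.\<close>

lemma normal_equations:
  fixes r :: "nat \<Rightarrow> real"
  assumes W: "component_size N \<gamma> k \<noteq> 0"
    and D: "weighted_mean N \<gamma> k (\<lambda>n. (d n)\<^sup>2) - (weighted_mean N \<gamma> k d)\<^sup>2 \<noteq> 0"
  defines "e \<equiv> \<lambda>n. r n - opt_beta N \<gamma> d r k - opt_alpha N \<gamma> d r k * d n"
  shows "(\<Sum>n\<in>{1..N}. \<gamma> n k * e n) = 0"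
    and "(\<Sum>n\<in>{1..N}. \<gamma> n k * (e n * d n)) = 0"
proof -
  let ?W = "component_size N \<gamma> k" and ?M = "weighted_mean N \<gamma> k"
  let ?A = "opt_alpha N \<gamma> d r k" and ?B = "opt_beta N \<gamma> d r k"
  let ?D = "?M (\<lambda>n. (d n)\<^sup>2) - (?M d)\<^sup>2"
  have AD: "?A * ?D = ?M (\<lambda>n. d n * r n) - ?M d * ?M r"
    using D by (simp add: opt_alpha_def)
  have BD: "?B * ?D = ?M (\<lambda>n. (d n)\<^sup>2) * ?M r - ?M d * ?M (\<lambda>n. d n * r n)"
    using D by (simp add: opt_beta_def)
  have "(\<Sum>n\<in>{1..N}. \<gamma> n k * e n) =
      (\<Sum>n\<in>{1..N}. \<gamma> n k * r n) - ?B * ?W - ?A * (\<Sum>n\<in>{1..N}. \<gamma> n k * d n)"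
    by (simp add: e_def component_size_def sum_distrib_left flip: sum_subtractf)
      (simp add: algebra_simps)
  also have "\<dots> = ?W * (?M r - ?B - ?A * ?M d)"
    by (simp only: weighted_sum_eq[OF W]) (simp add: algebra_simps)
  also have "?M r - ?B - ?A * ?M d = 0"
  proof -
    \<comment> \<open>Multiplying by the nonzero \<open>?D\<close> lets \<open>AD\<close> and
      \<open>BD\<close> remove the quotients; a polynomial identity in the means remains.\<close>
    have "(?M r - ?B - ?A * ?M d) * ?D = ?M r * ?D - ?B * ?D - ?A * ?D * ?M d"
      by (simp add: algebra_simps)
    also have "\<dots> = 0"
      unfolding AD BD by (simp add: algebra_simps power2_eq_square)
    finally show ?thesis using D by simp
  qed
  finally show "(\<Sum>n\<in>{1..N}. \<gamma> n k * e n) = 0" by simp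
  have "(\<Sum>n\<in>{1..N}. \<gamma> n k * (e n * d n)) = (\<Sum>n\<in>{1..N}. \<gamma> n k * (d n * r n))
      - ?B * (\<Sum>n\<in>{1..N}. \<gamma> n k * d n) - ?A * (\<Sum>n\<in>{1..N}. \<gamma> n k * (d n)\<^sup>2)"
    by (simp add: e_def sum_distrib_left flip: sum_subtractf)
      (simp add: algebra_simps power2_eq_square)
  also have "\<dots> = ?W * (?M (\<lambda>n. d n * r n) - ?B * ?M d - ?A * ?M (\<lambda>n. (d n)\<^sup>2))"
    by (simp only: weighted_sum_eq[OF W]) (simp add: algebra_simps)
  also have "?M (\<lambda>n. d n * r n) - ?B * ?M d - ?A * ?M (\<lambda>n. (d n)\<^sup>2) = 0"
  proof -
    have "(?M (\<lambda>n. d n * r n) - ?B * ?M d - ?A * ?M (\<lambda>n. (d n)\<^sup>2)) * ?D =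
        ?M (\<lambda>n. d n * r n) * ?D - ?B * ?D * ?M d - ?A * ?D * ?M (\<lambda>n. (d n)\<^sup>2)"
      by (simp add: algebra_simps)
    also have "\<dots> = 0"
      unfolding AD BD by (simp add: algebra_simps power2_eq_square)
    finally show ?thesis using D by simp
  qed
  finally show "(\<Sum>n\<in>{1..N}. \<gamma> n k * (e n * d n)) = 0" by simp
qed

text \<open>Pythagoras for weighted least squares: the residual of (a, b) is the fitted residual
  plus an affine function of \<open>d\<close>, and the two are orthogonal by the normal
  equations.\<close>

lemma weighted_rss_decomposition:
  fixes r :: "nat \<Rightarrow> real"
  assumes "component_size N \<gamma> k \<noteq> 0"
    and "weighted_mean N \<gamma> k (\<lambda>n. (d n)\<^sup>2) - (weighted_mean N \<gamma> k d)\<^sup>2 \<noteq> 0"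
  defines "A \<equiv> opt_alpha N \<gamma> d r k" and "B \<equiv> opt_beta N \<gamma> d r k"
  shows "(\<Sum>n\<in>{1..N}. \<gamma> n k * (r n - b - a * d n)\<^sup>2) =
    (\<Sum>n\<in>{1..N}. \<gamma> n k * (r n - B - A * d n)\<^sup>2) +
    (\<Sum>n\<in>{1..N}. \<gamma> n k * (B - b + (A - a) * d n)\<^sup>2)"
proof -
  define e where "e n = r n - B - A * d n" for n
  have orth: "(\<Sum>n\<in>{1..N}. \<gamma> n k * e n) = 0" "(\<Sum>n\<in>{1..N}. \<gamma> n k * (e n * d n)) = 0"
    using normal_equations[OF assms(1,2), of r] by (simp_all add: e_def A_def B_def)
  \<comment> \<open>The cross term is split so that, after summation, it becomes a combination of
    the two sums in \<open>orth\<close>.\<close>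
  have "\<gamma> n k * (r n - b - a * d n)\<^sup>2 =
      \<gamma> n k * (e n)\<^sup>2 + \<gamma> n k * (B - b + (A - a) * d n)\<^sup>2 +
      (2 * (B - b) * (\<gamma> n k * e n) + 2 * (A - a) * (\<gamma> n k * (e n * d n)))" for n
    unfolding e_def by (simp add: power2_eq_square algebra_simps)
  then have "(\<Sum>n\<in>{1..N}. \<gamma> n k * (r n - b - a * d n)\<^sup>2) =
      (\<Sum>n\<in>{1..N}. \<gamma> n k * (e n)\<^sup>2) + (\<Sum>n\<in>{1..N}. \<gamma> n k * (B - b + (A - a) * d n)\<^sup>2) +
      (2 * (B - b) * (\<Sum>n\<in>{1..N}. \<gamma> n k * e n) +
       2 * (A - a) * (\<Sum>n\<in>{1..N}. \<gamma> n k * (e n * d n)))"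
    by (simp only: sum.distrib sum_distrib_left)
  then show ?thesis
    by (simp only: orth) (simp add: e_def)
qed

text \<open>A nonzero affine function has at most one root, while \<open>d\<close> takes at least
  two values. This gives uniqueness of the fitted slope and intercept.\<close>

lemma weighted_sum_squares_affine_pos:
  fixes N :: nat and s t :: real
  assumes pos: "\<forall>n\<in>{1..N}. \<gamma> n k > 0"
    and not_const: "\<exists>m\<in>{1..N}. \<exists>n\<in>{1..N}. d m \<noteq> d n"
    and ne: "s \<noteq> 0 \<or> t \<noteq> 0"
  shows "(\<Sum>n\<in>{1..N}. \<gamma> n k * (s + t * d n)\<^sup>2) > 0"
proof -
  obtain i j where ij: "i \<in> {1..N}" "j \<in> {1..N}" "d i \<noteq> d j"
    using not_const by auto
  have "\<exists>n\<in>{1..N}. s + t * d n \<noteq> 0"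
  proof (rule ccontr)
    assume "\<not> ?thesis"
    with ij have "s + t * d i = 0" "s + t * d j = 0" by auto
    then have "t * (d i - d j) = 0" unfolding right_diff_distrib by linarith
    with ij \<open>s + t * d i = 0\<close> ne show False by simp
  qed
  then obtain n where n: "n \<in> {1..N}" "s + t * d n \<noteq> 0" ..
  show ?thesis
    by (rule sum_pos2[OF _ n(1)]) (use pos n in \<open>auto simp: less_imp_le\<close>)
qed

lemma objective_eq:
  "objective N \<gamma> d r k (a, b, v) = component_size N \<gamma> k * ln v +
    (\<Sum>n\<in>{1..N}. \<gamma> n k * (r n - b - a * d n)\<^sup>2) / v"
  by (simp add: objective_def component_size_def distrib_left sum.distrib sum_distrib_right
      sum_divide_distrib)

lemma objective_optimum_less:
  assumes pos: "\<forall>n\<in>{1..N}. \<gamma> n k > 0"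
    and not_const: "\<exists>m\<in>{1..N}. \<exists>n\<in>{1..N}. d m \<noteq> d n"
    and v: "v > 0" and V: "opt_variance N \<gamma> d r k > 0"
    and ne: "(a, b, v) \<noteq> (opt_alpha N \<gamma> d r k, opt_beta N \<gamma> d r k, opt_variance N \<gamma> d r k)"
  shows "objective N \<gamma> d r k (opt_alpha N \<gamma> d r k, opt_beta N \<gamma> d r k, opt_variance N \<gamma> d r k)
    < objective N \<gamma> d r k (a, b, v)"
proof -
  define W where "W = component_size N \<gamma> k"
  define A where "A = opt_alpha N \<gamma> d r k"
  define B where "B = opt_beta N \<gamma> d r k"
  define V where "V = opt_variance N \<gamma> d r k"
  define Q where "Q = (\<Sum>n\<in>{1..N}. \<gamma> n k * (B - b + (A - a) * d n)\<^sup>2)"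
  have "N \<ge> 1" using not_const by auto
  then have W: "W > 0"
    unfolding W_def using pos by (rule component_size_pos)
  have V0: "V > 0" using V by (simp add: V_def)
  have rss_opt: "(\<Sum>n\<in>{1..N}. \<gamma> n k * (r n - B - A * d n)\<^sup>2) = W * V"
    using W by (simp add: V_def opt_variance_def A_def B_def W_def)
  have rss: "(\<Sum>n\<in>{1..N}. \<gamma> n k * (r n - b - a * d n)\<^sup>2) = W * V + Q"
    using weighted_rss_decomposition[of N \<gamma> k d r b a] W
      weighted_variance_pos[of N \<gamma> k d, OF pos not_const] rss_opt
    by (simp add: A_def B_def Q_def W_def)
  \<comment> \<open>By \<open>rss_opt\<close> the quotient term of the objective at the optimum is
    \<open>W * V / V = W\<close>, which accounts for the -1.\<close>
  have gap: "objective N \<gamma> d r k (a, b, v) - objective N \<gamma> d r k (A, B, V) =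
      W * (V / v - 1 - ln (V / v)) + Q / v"
    using v V0 unfolding objective_eq rss rss_opt W_def[symmetric]
    by (simp add: ln_div field_simps)
  have ln_le: "ln (V / v) \<le> V / v - 1"
    using v V0 by (intro ln_le_minus_one) simp
  have Q: "Q \<ge> 0"
    unfolding Q_def by (intro sum_nonneg mult_nonneg_nonneg) (use pos in \<open>auto simp: less_imp_le\<close>)
  have "0 < W * (V / v - 1 - ln (V / v)) + Q / v"
  \<comment> \<open>If the variances agree, the difference lies in (a, b) and \<open>Q\<close> is
    positive; otherwise \<open>ln x \<le> x - 1\<close> is strict at \<open>V / v\<close>, which is
    not 1.\<close>
  proof (cases "v = V")
    case True
    with ne have "B - b \<noteq> 0 \<or> A - a \<noteq> 0" by (auto simp: A_def B_def V_def)
    then have "Q > 0"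
      unfolding Q_def by (rule weighted_sum_squares_affine_pos[of N \<gamma> k d, OF pos not_const])
    with v W ln_le show ?thesis by (intro add_nonneg_pos) simp_all
  next
    case False
    then have "ln (V / v) \<noteq> V / v - 1"
      using v V0 ln_eq_minus_one[of "V / v"] by auto
    with ln_le v W Q show ?thesis by (intro add_pos_nonneg mult_pos_pos) simp_all
  qed
  with gap show ?thesis by (simp add: A_def B_def V_def)
qed

text \<open>The fitted line, like any other, misses some data point. This puts the candidate optimum
  inside the feasible region.\<close>

lemma opt_variance_pos:
  assumes "N \<ge> 1" and pos: "\<forall>n\<in>{1..N}. \<gamma> n k > 0"
    and no_exact_fit: "\<not> (\<exists>a b. \<forall>n\<in>{1..N}. r n = b + a * d n)"
  shows "opt_variance N \<gamma> d r k > 0"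
proof -
  let ?A = "opt_alpha N \<gamma> d r k" and ?B = "opt_beta N \<gamma> d r k"
  obtain n where n: "n \<in> {1..N}" "r n \<noteq> ?B + ?A * d n"
    using no_exact_fit by blast
  have "0 < (\<Sum>n\<in>{1..N}. \<gamma> n k * (r n - ?B - ?A * d n)\<^sup>2)"
    by (rule sum_pos2[OF _ n(1)]) (use pos n in \<open>auto simp: less_imp_le\<close>)
  then show ?thesis
    unfolding opt_variance_def using component_size_pos[of N \<gamma> k, OF assms(1,2)] by (rule divide_pos_pos)
qed

text \<open>The last three hypotheses exclude degenerate cases: with \<open>mix_old k = 0\<close>
  the objective is identically zero, with constant \<open>d\<close> the line is not determined, and
  with an exact fit the objective tends to minus infinity as \<open>v\<close> tends to 0.\<close>

theorem mainTheorem1: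
  fixes N K k :: nat
    and q :: "nat \<Rightarrow> 'a::euclidean_space"
    and r d :: "nat \<Rightarrow> real"
    and mix_old \<alpha>_old \<beta>_old \<sigma>_old :: "nat \<Rightarrow> real"
    and \<gamma> :: "nat \<Rightarrow> nat \<Rightarrow> real"
  assumes "N \<ge> 1" and "K \<ge> 1"
    and "\<forall>n\<in>{1..N}. q n \<noteq> 0"
    and "\<forall>j\<in>{1..K}. 0 \<le> mix_old j \<and> mix_old j \<le> 1"
    and "(\<Sum>j\<in>{1..K}. mix_old j) = 1"
    and "\<forall>j\<in>{1..K}. \<sigma>_old j > 0"
    and d_eq: "d = log_distance q"
    and gamma_eq: "\<gamma> = responsibility K mix_old \<alpha>_old \<beta>_old \<sigma>_old d r"
    and "k \<in> {1..K}"
    and active: "mix_old k > 0"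
    and not_const: "\<exists>m\<in>{1..N}. \<exists>n\<in>{1..N}. d m \<noteq> d n"
    and no_exact_fit: "\<not> (\<exists>a b. \<forall>n\<in>{1..N}. r n = b + a * d n)"
  shows "is_arg_min (objective N \<gamma> d r k) feasible (a, b, v) \<longleftrightarrow>
    a = opt_alpha N \<gamma> d r k \<and> b = opt_beta N \<gamma> d r k \<and> v = opt_variance N \<gamma> d r k"
proof -
  have pos: "\<forall>n\<in>{1..N}. \<gamma> n k > 0"
    unfolding gamma_eq using assms(4,6,9) active by (auto intro!: responsibility_pos)
  define x where "x = (opt_alpha N \<gamma> d r k, opt_beta N \<gamma> d r k, opt_variance N \<gamma> d r k)"
  have V: "opt_variance N \<gamma> d r k > 0"
    using \<open>N \<ge> 1\<close> pos no_exact_fit by (rule opt_variance_pos)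
  then have x: "feasible x" by (simp add: x_def feasible_def)
  have less: "objective N \<gamma> d r k x < objective N \<gamma> d r k y" if "feasible y" "y \<noteq> x" for y
    using that objective_optimum_less[of N \<gamma> k d _ r, OF pos not_const _ V]
    by (cases y) (auto simp: x_def feasible_def)
  \<comment> \<open>Since \<open>x\<close> strictly beats every other feasible point, it is a
    minimizer and no other point can be one.\<close>
  have "is_arg_min (objective N \<gamma> d r k) feasible y \<longleftrightarrow> y = x" for y
    unfolding is_arg_min_def using x less by (metis less_asym less_irrefl)
  then show ?thesis by (simp add: x_def)
qed

end
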